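(* Let $f_k(x;y_1,\dots,y_n)$ ($k=1,\dots,n$) be given smooth functions, and let $y_1(x),\dots,y_n(x)$ be the exact solution of the initial value problem $$\frac{dy_k}{dx}=f_k(x;y_1,\dots,y_n),\qquad y_k(x_0)=y_{k0}\qquad (k=1,\dots,n).$$ Let $h$ be the time step, $x_{i+1}=x_i+h$, $y_{k,i}=y_k(x_i)$, $f_{k,i}=f_k(x_i;y_1(x_i),\dots,y_n(x_i))$, and $z_{k,i}=y_{k,i}+h f_{k,i}$, and suppose that $$f_k(x_{i+1};z_{1,i},\dots,z_{n,i})-f_{k,i}\neq 0\qquad(k=1,\dots,n).$$ Set $$\alpha_k=1-\frac{\sum_{m=2}^{\infty}\frac{h^{m-1}}{m!}\,(D^{m-1}f_k)(x_i;y_{1,i},\dots,y_{n,i})}{f_k(x_{i+1};z_{1,i},\dots,z_{n,i})-f_{k,i}},\qquad D=\frac{\partial}{\partial x}+f_1\frac{\partial}{\partial y_1}+\cdots+f_n\frac{\partial}{\partial y_n}.$$ Then the numerical scheme $$y_{k,i+1}=y_{k,i}+h\bigl[\alpha_k f_{k,i}+(1-\alpha_k)f_k(x_{i+1};z_{1,i},z_{2,i},\dots,z_{n,i})\bigr]\qquad(k=1,\dots,n)$$ has zero truncation error, that is, the value $y_{k,i+1}$ it produces equals the exact value $y_k(x_{i+1})$ for $k=1,\dots,n$.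
   Context: The operator $D$ acts on smooth functions of the variables $(x,y_1,\dots,y_n)$; $D^{m-1}$ is its $(m-1)$-fold iterate, and $(D^{m-1}f_k)(x_i;y_{1,i},\dots,y_{n,i})$ denotes the function $D^{m-1}f_k$ evaluated at the point $(x_i,y_{1,i},\dots,y_{n,i})$. The truncation error of the scheme at step $i$ is the difference between $y_k(x_{i+1})$ and the right-hand side of the scheme when the exact values $y_{k,i}=y_k(x_i)$ are inserted.
   Formalization: Adds the hypothesis that the Taylor series of each y_k at x_i converges to y_k(x_{i+1}); for merely smooth f_k the claim fails, e.g. n=1, f=φ'(x), φ=exp(-1/x²), φ(0)=0, x_i=0, y=φ: the scheme gives 0, not φ(h). *)

theory Defs
  imports "HOL-Analysis.Analysis"
begin

(* On open sets in finite dimension this is the usual C^r: the function is r times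
   differentiable and all iterated directional derivatives up to order r are continuous. *)
primrec Ck_on ::
  "nat \<Rightarrow> 'a::real_normed_vector set \<Rightarrow> ('a \<Rightarrow> 'b::real_normed_vector) \<Rightarrow> bool" where
  "Ck_on 0 S g \<longleftrightarrow> continuous_on S g"
| "Ck_on (Suc r) S g \<longleftrightarrow>
     (\<forall>p\<in>S. g differentiable (at p)) \<and>
     (\<forall>v. Ck_on r S (\<lambda>p. frechet_derivative g (at p) v))"

definition smooth_on ::
  "'a::real_normed_vector set \<Rightarrow> ('a \<Rightarrow> 'b::real_normed_vector) \<Rightarrow> bool" where
  "smooth_on S g \<longleftrightarrow> (\<forall>r. Ck_on r S g)"

(* Points (x; y_1, ..., y_n) are pairs in real \<times> (real^'n). *)

definition partial_x :: "(real \<times> (real^'n) \<Rightarrow> real) \<Rightarrow> real \<times> (real^'n) \<Rightarrow> real" where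
  "partial_x g p = deriv (\<lambda>t. g (t, snd p)) (fst p)"

definition partial_y :: "'n \<Rightarrow> (real \<times> (real^'n) \<Rightarrow> real) \<Rightarrow> real \<times> (real^'n) \<Rightarrow> real" where
  "partial_y j g p = deriv (\<lambda>t. g (fst p, \<chi> l. if l = j then t else snd p $ l)) (snd p $ j)"

definition D_op ::
  "('n \<Rightarrow> real \<times> (real^'n) \<Rightarrow> real) \<Rightarrow> (real \<times> (real^'n) \<Rightarrow> real) \<Rightarrow> real \<times> (real^'n) \<Rightarrow> real" where
  "D_op f g = (\<lambda>p. partial_x g p + (\<Sum>j\<in>UNIV. f j p * partial_y j g p))"

definition predictor ::
  "('n \<Rightarrow> real \<times> (real^'n) \<Rightarrow> real) \<Rightarrow> real \<Rightarrow> real \<Rightarrow> real^'n \<Rightarrow> real^'n" where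
  "predictor f h x u = (\<chi> j. u $ j + h * f j (x, u))"

definition scheme_step ::
  "('n \<Rightarrow> real \<times> (real^'n) \<Rightarrow> real) \<Rightarrow> real \<Rightarrow> ('n \<Rightarrow> real) \<Rightarrow> real \<Rightarrow> real^'n \<Rightarrow> 'n \<Rightarrow> real" where
  "scheme_step f h \<alpha> x u k =
     u $ k + h * (\<alpha> k * f k (x, u) + (1 - \<alpha> k) * f k (x + h, predictor f h x u))"

definition truncation_error ::
  "('n \<Rightarrow> real \<times> (real^'n) \<Rightarrow> real) \<Rightarrow> real \<Rightarrow> ('n \<Rightarrow> real) \<Rightarrow> ('n \<Rightarrow> real \<Rightarrow> real) \<Rightarrow> real \<Rightarrow> 'n \<Rightarrow> real" where
  "truncation_error f h \<alpha> y x k = y k (x + h) - scheme_step f h \<alpha> x (\<chi> j. y j x) k"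

(* The sum over m \<ge> 2 of h^(m-1)/m! (D^(m-1) g)(p), shifted to start at 0. *)
definition D_series ::
  "('n \<Rightarrow> real \<times> (real^'n) \<Rightarrow> real) \<Rightarrow> real \<Rightarrow> (real \<times> (real^'n) \<Rightarrow> real) \<Rightarrow> real \<times> (real^'n) \<Rightarrow> real" where
  "D_series f h g p = (\<Sum>m. h ^ (m + 1) / fact (m + 2) * (D_op f ^^ (m + 1)) g p)"

end

theory Submission
  imports Defs
begin

text \<open>
  Along a solution curve the chain rule turns d/dt g(t, y(t)) into (D g)(t, y(t)), so the
  derivative of order m + 1 of y_k is D^m f_k evaluated on the curve; smoothness of the f_k
  makes the iterates D^m f_k differentiable on the domain. The Taylor series of y_k therefore reads
  y_k(x + h) = y_k + h f_k + h S_k, where S_k is the series in the numerator of 1 - alpha_k, and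
  the choice of alpha_k makes the step of the scheme equal to the same expression.
\<close>

section \<open>Closure properties of C^r and smooth functions on open sets\<close>

lemma Ck_on_cong:
  assumes "open S" "\<And>p. p \<in> S \<Longrightarrow> f p = g p" "Ck_on r S f"
  shows "Ck_on r S g"
  using assms(2,3)
proof (induction r arbitrary: f g)
  case 0
  then show ?case using continuous_on_cong[of S S f g] by auto
next
  case (Suc r)
  \<comment> \<open>Openness of \<open>S\<close> enters here: \<open>f\<close> and \<open>g\<close>
    agree on a neighbourhood of \<open>p\<close>, so a derivative of one is a derivative of the
    other.\<close>
  have der: "(g has_derivative frechet_derivative f (at p)) (at p)" if "p \<in> S" for p
  proof -
    have "(f has_derivative frechet_derivative f (at p)) (at p)"
      using Suc.prems(2) that frechet_derivative_works by auto
    then show ?thesis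
      using has_derivative_transform_within_open[OF _ assms(1) that] Suc.prems(1) by blast
  qed
  have eq: "frechet_derivative f (at p) v = frechet_derivative g (at p) v" if "p \<in> S" for p v
    by (simp add: frechet_derivative_at[OF der[OF that], symmetric])
  have "Ck_on r S (\<lambda>p. frechet_derivative g (at p) v)" for v
    using Suc.IH[of "\<lambda>p. frechet_derivative f (at p) v"] eq Suc.prems(2) by simp
  moreover have "g differentiable (at p)" if "p \<in> S" for p
    using der[OF that] differentiable_def by blast
  ultimately show ?case by simp
qed

text \<open>Needed for the product rule, whose undifferentiated factors must be lowered from class
  \<open>Suc r\<close> to class \<open>r\<close>. At the bottom of the induction, differentiability
  gives continuity.\<close>

lemma Ck_on_SucD: "Ck_on (Suc r) S f \<Longrightarrow> Ck_on r S f"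
proof (induction r arbitrary: f)
  case 0
  then show ?case
    by (auto intro!: continuous_at_imp_continuous_on differentiable_imp_continuous_within)
next
  case (Suc r)
  have "Ck_on r S (\<lambda>p. frechet_derivative f (at p) v)" for v
    using Suc.prems Ck_on.simps(2)[of "Suc r" S f] by (blast intro: Suc.IH)
  then show ?case using Suc.prems by simp
qed

lemma Ck_on_const: "Ck_on r S (\<lambda>p. c)"
  by (induction r arbitrary: c) auto

lemma Ck_on_add:
  assumes "open S" "Ck_on r S f" "Ck_on r S g"
  shows "Ck_on r S (\<lambda>p. f p + g p)"
  using assms(2,3)
proof (induction r arbitrary: f g)
  case 0
  then show ?case by (auto intro: continuous_on_add)
next
  case (Suc r)
  have der: "((\<lambda>p. f p + g p) has_derivative
      (\<lambda>v. frechet_derivative f (at p) v + frechet_derivative g (at p) v)) (at p)"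
    if "p \<in> S" for p
    using Suc.prems that by (intro has_derivative_add) (auto simp: frechet_derivative_works[symmetric])
  have eq: "frechet_derivative f (at p) v + frechet_derivative g (at p) v
      = frechet_derivative (\<lambda>p. f p + g p) (at p) v" if "p \<in> S" for p v
    by (simp add: frechet_derivative_at[OF der[OF that], symmetric])
  have "Ck_on r S (\<lambda>p. frechet_derivative f (at p) v + frechet_derivative g (at p) v)" for v
    using Suc.prems by (intro Suc.IH) simp_all
  \<comment> \<open>The sum rule is available only at points of \<open>S\<close>; elsewhere
    \<open>f\<close> or \<open>g\<close> may fail to be differentiable and
    \<open>frechet_derivative\<close> is then unspecified. Hence the passage through
    \<open>Ck_on_cong\<close> instead of a rewrite of functions.\<close>
  then have "Ck_on r S (\<lambda>p. frechet_derivative (\<lambda>p. f p + g p) (at p) v)" for v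
    by (rule Ck_on_cong[OF assms(1), rotated]) (rule eq)
  then show ?case using Suc.prems by simp
qed

lemma Ck_on_mult:
  fixes f g :: "'a::real_normed_vector \<Rightarrow> 'b::real_normed_algebra"
  assumes "open S" "Ck_on r S f" "Ck_on r S g"
  shows "Ck_on r S (\<lambda>p. f p * g p)"
  using assms(2,3)
proof (induction r arbitrary: f g)
  case 0
  then show ?case by (auto intro: continuous_on_mult)
next
  case (Suc r)
  have der: "((\<lambda>p. f p * g p) has_derivative
      (\<lambda>v. f p * frechet_derivative g (at p) v + frechet_derivative f (at p) v * g p)) (at p)"
    if "p \<in> S" for p
    using Suc.prems that by (intro has_derivative_mult) (auto simp: frechet_derivative_works[symmetric])
  have eq: "f p * frechet_derivative g (at p) v + frechet_derivative f (at p) v * g p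
      = frechet_derivative (\<lambda>p. f p * g p) (at p) v" if "p \<in> S" for p v
    by (simp add: frechet_derivative_at[OF der[OF that], symmetric])
  \<comment> \<open>Each product pairs an undifferentiated factor with a directional derivative of
    the other, so the induction hypothesis has to be general in both factors.\<close>
  have "Ck_on r S (\<lambda>p. f p * frechet_derivative g (at p) v + frechet_derivative f (at p) v * g p)"
    for v
    using Suc.prems by (intro Ck_on_add[OF assms(1)] Suc.IH)
      (simp_all add: Ck_on_SucD del: Ck_on.simps, simp_all)
  then have "Ck_on r S (\<lambda>p. frechet_derivative (\<lambda>p. f p * g p) (at p) v)" for v
    by (rule Ck_on_cong[OF assms(1), rotated]) (rule eq)
  moreover have "(\<lambda>p. f p * g p) differentiable (at p)" if "p \<in> S" for p
    using der[OF that] differentiable_def by blast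
  ultimately show ?case by simp
qed

lemma smooth_on_cong:
  assumes "open S" "\<And>p. p \<in> S \<Longrightarrow> f p = g p" "smooth_on S f"
  shows "smooth_on S g"
  using assms(3) Ck_on_cong[OF assms(1,2)] by (simp add: smooth_on_def)

lemma smooth_on_add:
  assumes "open S" "smooth_on S f" "smooth_on S g"
  shows "smooth_on S (\<lambda>p. f p + g p)"
  using assms by (simp add: smooth_on_def Ck_on_add)

lemma smooth_on_mult:
  fixes f g :: "'a::real_normed_vector \<Rightarrow> 'b::real_normed_algebra"
  assumes "open S" "smooth_on S f" "smooth_on S g"
  shows "smooth_on S (\<lambda>p. f p * g p)"
  using assms by (simp add: smooth_on_def Ck_on_mult)

lemma smooth_on_sum:
  assumes "open S" "\<And>j. j \<in> A \<Longrightarrow> smooth_on S (f j)"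
  shows "smooth_on S (\<lambda>p. \<Sum>j\<in>A. f j p)"
  using assms(2)
proof (induction A rule: infinite_finite_induct)
  case (insert a A)
  then show ?case using smooth_on_add[OF assms(1)] by auto
qed (auto simp: smooth_on_def Ck_on_const)

lemma smooth_on_frechet_derivative:
  assumes "smooth_on S g"
  shows "smooth_on S (\<lambda>p. frechet_derivative g (at p) v)"
  unfolding smooth_on_def
proof
  fix r
  have "Ck_on (Suc r) S g" using assms by (simp only: smooth_on_def)
  then show "Ck_on r S (\<lambda>p. frechet_derivative g (at p) v)" by simp
qed

lemma smooth_on_imp_differentiable:
  assumes "smooth_on S g" "p \<in> S"
  shows "g differentiable (at p)"
proof -
  have "Ck_on (Suc 0) S g" using assms(1) by (simp only: smooth_on_def)
  then show ?thesis using assms(2) by simp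
qed

section \<open>The operator D in terms of the Frechet derivative\<close>

lemma partial_x_eq_frechet_derivative:
  assumes "g differentiable (at p)"
  shows "partial_x g p = frechet_derivative g (at p) (1, 0)"
proof -
  let ?L = "frechet_derivative g (at p)"
  have L: "(g has_derivative ?L) (at p)"
    using assms frechet_derivative_works by blast
  have c: "((\<lambda>t. (t, snd p)) has_derivative (\<lambda>s. (s, 0))) (at (fst p))"
    by (auto intro!: derivative_eq_intros)
  have "((\<lambda>t. g (t, snd p)) has_derivative (\<lambda>s. ?L (s, 0))) (at (fst p))"
    using has_derivative_compose[OF c, of g ?L] L by simp
  moreover have "(\<lambda>s. ?L (s, 0)) = (*) (?L (1, 0))"
  proof
    show "?L (s, 0) = ?L (1, 0) * s" for s
      using linear_scale[OF has_derivative_linear[OF L], of s "(1, 0)"] by simp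
  qed
  ultimately have "((\<lambda>t. g (t, snd p)) has_real_derivative ?L (1, 0)) (at (fst p))"
    by (simp only: has_field_derivative_def)
  then show ?thesis unfolding partial_x_def by (rule DERIV_imp_deriv)
qed

lemma partial_y_eq_frechet_derivative:
  assumes "g differentiable (at p)"
  shows "partial_y j g p = frechet_derivative g (at p) (0, axis j 1)"
proof -
  let ?L = "frechet_derivative g (at p)"
  let ?c = "\<lambda>t. (fst p, \<chi> l. if l = j then t else snd p $ l)"
  have L: "(g has_derivative ?L) (at p)"
    using assms frechet_derivative_works by blast
  \<comment> \<open>Replacing the j-th coordinate moves along an affine line with direction
    \<open>axis j 1\<close>; in this form its derivative can be read off.\<close>
  have "?c = (\<lambda>t. (fst p, snd p + (t - snd p $ j) *\<^sub>R axis j 1))"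
    by (auto simp: vec_eq_iff axis_def fun_eq_iff)
  then have c: "(?c has_derivative (\<lambda>s. (0, s *\<^sub>R axis j 1))) (at (snd p $ j))"
    by (auto intro!: derivative_eq_intros)
  \<comment> \<open>The line passes through \<open>p\<close> at parameter \<open>snd p $ j\<close>,
    the point where \<open>?L\<close> is the derivative of \<open>g\<close>.\<close>
  have "(\<chi> l. if l = j then snd p $ j else snd p $ l) = snd p"
    by (simp add: vec_eq_iff)
  then have "((\<lambda>t. g (?c t)) has_derivative (\<lambda>s. ?L (0, s *\<^sub>R axis j 1))) (at (snd p $ j))"
    using has_derivative_compose[OF c, of g ?L] L by simp
  moreover have "?L (0, s *\<^sub>R axis j 1) = ?L (0, axis j 1) * s" for s
    using linear_scale[OF has_derivative_linear[OF L], of s "(0, axis j 1)"] by simp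
  ultimately have "((\<lambda>t. g (?c t)) has_real_derivative ?L (0, axis j 1)) (at (snd p $ j))"
    by (simp add: has_field_derivative_def)
  then show ?thesis unfolding partial_y_def by (rule DERIV_imp_deriv)
qed

text \<open>The vector (1, f_1, ..., f_n) is expanded in the standard basis, on which the linear map
  \<open>?L\<close> takes the partial derivatives as values. Thus D differentiates along the vector
  field whose integral curves are the graphs of solutions.\<close>

lemma D_op_eq_frechet_derivative:
  fixes f :: "'n::finite \<Rightarrow> real \<times> (real^'n) \<Rightarrow> real"
  assumes "g differentiable (at p)"
  shows "D_op f g p = frechet_derivative g (at p) (1, \<chi> j. f j p)"
proof -
  let ?L = "frechet_derivative g (at p)"
  have lin: "linear ?L"
    using assms frechet_derivative_works has_derivative_linear by blast
  have "(\<chi> j. f j p) = (\<Sum>j\<in>UNIV. f j p *\<^sub>R axis j 1)"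
    by (simp add: vec_eq_iff axis_def if_distrib cong: if_cong)
  then have "(1::real, \<chi> j. f j p) = (1, 0) + (\<Sum>j\<in>UNIV. f j p *\<^sub>R (0, axis j 1))"
    by (simp add: prod_eq_iff fst_sum snd_sum)
  then have "?L (1, \<chi> j. f j p) = ?L (1, 0) + (\<Sum>j\<in>UNIV. f j p * ?L (0, axis j 1))"
    by (simp only: linear_add[OF lin] linear_sum[OF lin] linear_scale[OF lin] real_scaleR_def)
  then show ?thesis
    by (simp add: D_op_def partial_x_eq_frechet_derivative[OF assms]
        partial_y_eq_frechet_derivative[OF assms])
qed

text \<open>\<open>Ck_on\<close> controls derivatives in fixed directions only, while (1, f_1, ...,
  f_n) varies with the point. D is therefore kept as a sum of derivatives in the fixed basis
  directions with the smooth coefficients \<open>f j\<close>.\<close>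

lemma smooth_on_D_op:
  fixes f :: "'n::finite \<Rightarrow> real \<times> (real^'n) \<Rightarrow> real"
  assumes "open S" "\<And>j. smooth_on S (f j)" "smooth_on S g"
  shows "smooth_on S (D_op f g)"
proof (rule smooth_on_cong[OF assms(1)])
  show "smooth_on S (\<lambda>p. frechet_derivative g (at p) (1, 0)
      + (\<Sum>j\<in>UNIV. f j p * frechet_derivative g (at p) (0, axis j 1)))"
    by (intro smooth_on_add smooth_on_sum smooth_on_mult smooth_on_frechet_derivative assms)
qed (simp add: D_op_def partial_x_eq_frechet_derivative partial_y_eq_frechet_derivative
    smooth_on_imp_differentiable[OF assms(3)])

lemma smooth_on_D_op_funpow:
  fixes f :: "'n::finite \<Rightarrow> real \<times> (real^'n) \<Rightarrow> real"
  assumes "open S" "\<And>j. smooth_on S (f j)" "smooth_on S g"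
  shows "smooth_on S ((D_op f ^^ m) g)"
  by (induction m) (simp_all add: assms smooth_on_D_op)

section \<open>Derivatives along a solution curve\<close>

lemma has_real_derivative_along_solution:
  fixes f :: "'n::finite \<Rightarrow> real \<times> (real^'n) \<Rightarrow> real"
  assumes "g differentiable (at (t, \<chi> j. y j t))"
    and "\<And>k. (y k has_real_derivative f k (t, \<chi> j. y j t)) (at t)"
  shows "((\<lambda>s. g (s, \<chi> j. y j s)) has_real_derivative D_op f g (t, \<chi> j. y j t)) (at t)"
proof -
  let ?p = "(t, \<chi> j. y j t)"
  let ?L = "frechet_derivative g (at ?p)"
  have L: "(g has_derivative ?L) (at ?p)"
    using assms(1) frechet_derivative_works by blast
  \<comment> \<open>By the differential equation the graph has tangent vector (1, f_1, ..., f_n) at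
    \<open>t\<close>, exactly the direction of D.\<close>
  have "((\<lambda>s. \<chi> j. y j s) has_derivative (\<lambda>s. s *\<^sub>R (\<chi> j. f j ?p))) (at t)"
    unfolding has_derivative_componentwise_within[of "\<lambda>s. \<chi> j. y j s"]
    using assms(2)
    by (auto simp: Basis_vec_def inner_axis has_field_derivative_def mult_commute_abs)
  then have "((\<lambda>s. (s, \<chi> j. y j s)) has_derivative (\<lambda>s. (s, s *\<^sub>R (\<chi> j. f j ?p)))) (at t)"
    by (intro has_derivative_Pair has_derivative_ident)
  from has_derivative_compose[OF this, of g ?L]
  have "((\<lambda>s. g (s, \<chi> j. y j s)) has_derivative (\<lambda>s. ?L (s, s *\<^sub>R (\<chi> j. f j ?p)))) (at t)"
    using L by simp
  moreover have "?L (s, s *\<^sub>R (\<chi> j. f j ?p)) = ?L (1, \<chi> j. f j ?p) * s" for s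
    using linear_scale[OF has_derivative_linear[OF L], of s "(1, \<chi> j. f j ?p)"] by simp
  ultimately show ?thesis
    by (simp add: has_field_derivative_def D_op_eq_frechet_derivative[OF assms(1)])
qed

lemma higher_deriv_solution:
  fixes f :: "'n::finite \<Rightarrow> real \<times> (real^'n) \<Rightarrow> real"
  assumes "open \<Omega>" "\<And>k. smooth_on \<Omega> (f k)" "open I"
    and graph: "\<And>t. t \<in> I \<Longrightarrow> (t, \<chi> j. y j t) \<in> \<Omega>"
    and ode: "\<And>k t. t \<in> I \<Longrightarrow> (y k has_real_derivative f k (t, \<chi> j. y j t)) (at t)"
    and "t \<in> I"
  shows "(deriv ^^ Suc m) (y k) t = (D_op f ^^ m) (f k) (t, \<chi> j. y j t)"
  using \<open>t \<in> I\<close>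
proof (induction m arbitrary: t)
  case 0
  then show ?case using DERIV_imp_deriv[OF ode] by simp
next
  case (Suc m)
  let ?g = "(D_op f ^^ m) (f k)"
  have "smooth_on \<Omega> ?g"
    using assms by (intro smooth_on_D_op_funpow)
  then have "((\<lambda>s. ?g (s, \<chi> j. y j s)) has_real_derivative D_op f ?g (t, \<chi> j. y j t)) (at t)"
    using Suc.prems graph ode
    by (intro has_real_derivative_along_solution) (auto intro: smooth_on_imp_differentiable)
  \<comment> \<open>The induction hypothesis holds on all of the open set \<open>I\<close>, hence
    near \<open>t\<close>, so both sides may be differentiated there.\<close>
  then have "((deriv ^^ Suc m) (y k) has_real_derivative D_op f ?g (t, \<chi> j. y j t)) (at t)"
    by (rule has_field_derivative_transform_within_open[OF _ \<open>open I\<close> Suc.prems])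
      (simp only: Suc.IH)
  then show ?case using DERIV_imp_deriv by simp
qed

section \<open>From the Taylor series of the solution to the step of the scheme\<close>

theorem corollary1:
  fixes f :: "'n::finite \<Rightarrow> real \<times> (real^'n) \<Rightarrow> real"
    and \<Omega> :: "(real \<times> (real^'n)) set"
    and I :: "real set"
    and y :: "'n \<Rightarrow> real \<Rightarrow> real"
    and y0 :: "'n \<Rightarrow> real"
    and x :: "nat \<Rightarrow> real"
    and h x0 :: real
    and i :: nat
    and z :: "real^'n"
    and \<alpha> :: "'n \<Rightarrow> real"
  assumes "open \<Omega>"
    and smooth: "\<And>k. smooth_on \<Omega> (f k)"
    and "open I" and "is_interval I" and "x0 \<in> I"
    and graph: "\<And>t. t \<in> I \<Longrightarrow> (t, \<chi> j. y j t) \<in> \<Omega>"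
    and ode: "\<And>k t. t \<in> I \<Longrightarrow>
          (y k has_real_derivative f k (t, \<chi> j. y j t)) (at t)"
    and init: "\<And>k. y k x0 = y0 k"
    and grid: "x 0 = x0" "\<And>j. x (Suc j) = x j + h"
    and "x i \<in> I" and "x (Suc i) \<in> I"
    and z: "z = (\<chi> j. y j (x i) + h * f j (x i, \<chi> l. y l (x i)))"
    and "(x (Suc i), z) \<in> \<Omega>"
    and nonzero: "\<And>k. f k (x (Suc i), z) - f k (x i, \<chi> j. y j (x i)) \<noteq> 0"
    and taylor: "\<And>k. (\<lambda>m. h ^ m / fact m * (deriv ^^ m) (y k) (x i)) sums y k (x (Suc i))"
    and alpha: "\<And>k. \<alpha> k = 1 - D_series f h (f k) (x i, \<chi> j. y j (x i)) /
                      (f k (x (Suc i), z) - f k (x i, \<chi> j. y j (x i)))"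
  shows "\<forall>k. truncation_error f h \<alpha> y (x i) k = 0 \<and>
             scheme_step f h \<alpha> (x i) (\<chi> j. y j (x i)) k = y k (x (Suc i))"
proof
  fix k
  let ?p = "(x i, \<chi> j. y j (x i))"
  let ?F = "f k (x (Suc i), z)"
  have step: "x (Suc i) = x i + h" using grid by simp
  have z_eq: "predictor f h (x i) (\<chi> j. y j (x i)) = z"
    by (simp add: predictor_def z)
  \<comment> \<open>For h = 0 the point (\<open>x (Suc i)\<close>, \<open>z\<close>) would coincide
    with \<open>?p\<close>, and the difference in \<open>nonzero\<close> would vanish.\<close>
  have "h \<noteq> 0"
    using nonzero[of k] step by (auto simp: z)
  have deriv_eq: "(deriv ^^ Suc m) (y k) (x i) = (D_op f ^^ m) (f k) ?p" for m
    using higher_deriv_solution[OF \<open>open \<Omega>\<close> smooth \<open>open I\<close> graph ode \<open>x i \<in> I\<close>] .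
  \<comment> \<open>Convergence to the exact value is the hypothesis \<open>taylor\<close>, as
    smoothness alone does not give it. Removing the terms of order 0 and 1 aligns the index with
    \<open>D_series\<close>.\<close>
  have "(\<lambda>m. h ^ (m + 2) / fact (m + 2) * (deriv ^^ (m + 2)) (y k) (x i)) sums
      (y k (x (Suc i)) - (\<Sum>m<2. h ^ m / fact m * (deriv ^^ m) (y k) (x i)))"
    using sums_split_initial_segment[OF taylor] .
  moreover have "(\<Sum>m<2. h ^ m / fact m * (deriv ^^ m) (y k) (x i)) = y k (x i) + h * f k ?p"
    using deriv_eq[of 0] by (simp add: numeral_2_eq_2)
  moreover have "(deriv ^^ (m + 2)) (y k) (x i) = (D_op f ^^ (m + 1)) (f k) ?p" for m
    using deriv_eq[of "m + 1"] by simp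
  ultimately have "(\<lambda>m. h * (h ^ (m + 1) / fact (m + 2) * (D_op f ^^ (m + 1)) (f k) ?p)) sums
      (y k (x (Suc i)) - (y k (x i) + h * f k ?p))"
    by (simp add: mult.assoc del: funpow.simps fact_Suc)
  \<comment> \<open>Cancelling the common factor h transfers convergence as well, so the
    \<open>suminf\<close> in \<open>D_series\<close> is a genuine sum.\<close>
  then have "(\<lambda>m. h ^ (m + 1) / fact (m + 2) * (D_op f ^^ (m + 1)) (f k) ?p) sums
      ((y k (x (Suc i)) - (y k (x i) + h * f k ?p)) / h)"
    by (rule sums_mult_D[OF _ \<open>h \<noteq> 0\<close>])
  then have "D_series f h (f k) ?p = (y k (x (Suc i)) - (y k (x i) + h * f k ?p)) / h"
    unfolding D_series_def by (rule sums_unique[symmetric])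
  then have exact: "y k (x i) + h * (f k ?p + D_series f h (f k) ?p) = y k (x (Suc i))"
    using \<open>h \<noteq> 0\<close> by (simp add: field_simps)
  have "(1 - \<alpha> k) * (?F - f k ?p) = D_series f h (f k) ?p"
    using nonzero[of k] by (simp add: alpha)
  \<comment> \<open>The weighted mean of the two slopes is \<open>f k ?p\<close> plus (1 -
    \<open>\<alpha> k\<close>) times their difference; the weight is chosen so that this correction
    is the Taylor remainder divided by h.\<close>
  then have "\<alpha> k * f k ?p + (1 - \<alpha> k) * ?F = f k ?p + D_series f h (f k) ?p"
    by (simp add: algebra_simps)
  then have "scheme_step f h \<alpha> (x i) (\<chi> j. y j (x i)) k = y k (x (Suc i))"
    using exact z_eq by (simp add: scheme_step_def step)
  then show "truncation_error f h \<alpha> y (x i) k = 0 \<and>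
      scheme_step f h \<alpha> (x i) (\<chi> j. y j (x i)) k = y k (x (Suc i))"
    by (simp add: truncation_error_def step)
qed

end
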